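(* Let $(A,\circ)$ be a finite-dimensional Novikov algebra over $\mathbf{k}$ and let $r\in A\otimes A$ be skewsymmetric ($\tau r=-r$). Define $\Delta_r:A\to A\otimes A$ by $\Delta_r(a)=(L_A(a)\otimes\mathrm{id}+\mathrm{id}\otimes L_{A,\star}(a))r$ for all $a\in A$. Then $(A,\circ,\Delta_r)$ is a Novikov bialgebra if and only if for all $a\in A$ $$(L_A(a)\otimes\mathrm{id}\otimes\mathrm{id}-\mathrm{id}\otimes L_A(a)\otimes\mathrm{id})(\mathrm{id}\otimes\tau)(r\diamond r)+(\mathrm{id}\otimes\mathrm{id}\otimes L_{A,\star}(a))\big(r\diamond r-(\tau\otimes\mathrm{id})(r\diamond r)\big)=0,$$ $$(\mathrm{id}\otimes\mathrm{id}\otimes\mathrm{id}-\mathrm{id}\otimes\tau)(\mathrm{id}\otimes\mathrm{id}\otimes L_{A,\star}(a))(r\diamond r)=0,$$ where $r\diamond r:=r_{13}\circ r_{23}+r_{12}\star r_{23}+r_{13}\circ r_{12}$. In particular, if $r\diamond r=0$, then $(A,\circ,\Delta_r)$ is a Novikov bialgebra.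
   Context: $\mathbf{k}$ is a field of characteristic zero; $\tau(x\otimes y)=y\otimes x$. A Novikov algebra $(A,\circ)$: $(a\circ b)\circ c-a\circ(b\circ c)=(b\circ a)\circ c-b\circ(a\circ c)$ and $(a\circ b)\circ c=(a\circ c)\circ b$. Put $a\star b=a\circ b+b\circ a$, $L_A(a)b=a\circ b$, $R_A(a)b=b\circ a$, $L_{A,\star}=L_A+R_A$. For $r=\sum_\alpha x_\alpha\otimes y_\alpha$: $r_{13}\circ r_{23}=\sum_{\alpha,\beta}x_\alpha\otimes x_\beta\otimes y_\alpha\circ y_\beta$, $r_{12}\star r_{23}=\sum_{\alpha,\beta}x_\alpha\otimes y_\alpha\star x_\beta\otimes y_\beta$, $r_{13}\circ r_{12}=\sum_{\alpha,\beta}x_\alpha\circ x_\beta\otimes y_\beta\otimes y_\alpha$. The equation $r\diamond r=0$ is the Novikov Yang-Baxter equation (NYBE) in $A$. A Novikov coalgebra $(A,\Delta)$: $\Delta:A\to A\otimes A$ linear with $(\mathrm{id}\otimes\Delta)\Delta-(\tau\otimes\mathrm{id})(\mathrm{id}\otimes\Delta)\Delta=(\Delta\otimes\mathrm{id})\Delta-(\tau\otimes\mathrm{id})(\Delta\otimes\mathrm{id})\Delta$ and $(\tau\otimes\mathrm{id})(\mathrm{id}\otimes\Delta)\tau\Delta=(\Delta\otimes\mathrm{id})\Delta$. A Novikov bialgebra is $(A,\circ,\Delta)$ with $(A,\circ)$ a Novikov algebra, $(A,\Delta)$ a Novikov coalgebra and for all $a,b\in A$: $\Delta(a\circ b)=(R_A(b)\otimes\mathrm{id})\Delta(a)+(\mathrm{id}\otimes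 L_{A,\star}(a))(\Delta(b)+\tau\Delta(b))$; $(L_{A,\star}(a)\otimes\mathrm{id})\Delta(b)-(\mathrm{id}\otimes L_{A,\star}(a))\tau\Delta(b)=(L_{A,\star}(b)\otimes\mathrm{id})\Delta(a)-(\mathrm{id}\otimes L_{A,\star}(b))\tau\Delta(a)$; $(\mathrm{id}\otimes R_A(a)-R_A(a)\otimes\mathrm{id})(\Delta(b)+\tau\Delta(b))=(\mathrm{id}\otimes R_A(b)-R_A(b)\otimes\mathrm{id})(\Delta(a)+\tau\Delta(a))$. *)

theory Defs
  imports Complex_Main "HOL-Library.Poly_Mapping"
begin

section \<open>Free vector spaces and tensor powers\<close>

text \<open>
  The tensor product over \<open>'k\<close> of vector spaces is built in the standard way, as the quotient of
  the free vector space on tuples by the subspace spanned by the multilinearity relations.  This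
  subspace depends on the scalar multiplication, which is a term and not part of the type, so there
  is no quotient type: an element of \<open>A \<otimes> A\<close> or \<open>A \<otimes> A \<otimes> A\<close> is given by a formal linear combination
  of pairs or triples representing it, and equality of tensors is the congruence \<open>tens_eq2\<close> or
  \<open>tens_eq3\<close> below.  Both \<open>(A \<otimes> A) \<otimes> A\<close> and \<open>A \<otimes> (A \<otimes> A)\<close> are identified with \<open>A \<otimes> A \<otimes> A\<close>.
\<close>

type_synonym ('a, 'k) formal2 = "('a \<times> 'a) \<Rightarrow>\<^sub>0 'k"
type_synonym ('a, 'k) formal3 = "('a \<times> 'a \<times> 'a) \<Rightarrow>\<^sub>0 'k"

definition fscale :: "'k::field \<Rightarrow> ('x \<Rightarrow>\<^sub>0 'k) \<Rightarrow> ('x \<Rightarrow>\<^sub>0 'k)"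
  where "fscale c p = Poly_Mapping.map ((*) c) p"

lemma lookup_fscale [simp]:
  "Poly_Mapping.lookup (fscale c p) x = c * Poly_Mapping.lookup p x"
  by (simp add: fscale_def Poly_Mapping.map.rep_eq when_def)

global_interpretation free: vector_space "fscale :: 'k::field \<Rightarrow> ('x \<Rightarrow>\<^sub>0 'k) \<Rightarrow> ('x \<Rightarrow>\<^sub>0 'k)"
  by standard (auto intro!: poly_mapping_eqI simp: lookup_add algebra_simps)

definition gen :: "'x \<Rightarrow> ('x \<Rightarrow>\<^sub>0 'k::field)"
  where "gen x = Poly_Mapping.single x 1"

text \<open>The linear map between free vector spaces that takes the value \<open>f x\<close> at the generator \<open>x\<close>.\<close>

definition lin_ext :: "('x \<Rightarrow> ('y \<Rightarrow>\<^sub>0 'k::field)) \<Rightarrow> ('x \<Rightarrow>\<^sub>0 'k) \<Rightarrow> ('y \<Rightarrow>\<^sub>0 'k)"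
  where "lin_ext f p = (\<Sum>x \<in> Poly_Mapping.keys p. fscale (Poly_Mapping.lookup p x) (f x))"

definition tens_rels2 ::
    "('k::field \<Rightarrow> 'a::ab_group_add \<Rightarrow> 'a) \<Rightarrow> ('a, 'k) formal2 set"
  where "tens_rels2 scale =
    {gen (x + x', y) - gen (x, y) - gen (x', y) | x x' y. True} \<union>
    {gen (x, y + y') - gen (x, y) - gen (x, y') | x y y'. True} \<union>
    {gen (scale c x, y) - fscale c (gen (x, y)) | c x y. True} \<union>
    {gen (x, scale c y) - fscale c (gen (x, y)) | c x y. True}"

definition tens_eq2 ::
    "('k::field \<Rightarrow> 'a::ab_group_add \<Rightarrow> 'a) \<Rightarrow> ('a, 'k) formal2 \<Rightarrow> ('a, 'k) formal2 \<Rightarrow> bool"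
  where "tens_eq2 scale p q \<longleftrightarrow> p - q \<in> free.span (tens_rels2 scale)"

definition tens_rels3 ::
    "('k::field \<Rightarrow> 'a::ab_group_add \<Rightarrow> 'a) \<Rightarrow> ('a, 'k) formal3 set"
  where "tens_rels3 scale =
    {gen (x + x', y, z) - gen (x, y, z) - gen (x', y, z) | x x' y z. True} \<union>
    {gen (x, y + y', z) - gen (x, y, z) - gen (x, y', z) | x y y' z. True} \<union>
    {gen (x, y, z + z') - gen (x, y, z) - gen (x, y, z') | x y z z'. True} \<union>
    {gen (scale c x, y, z) - fscale c (gen (x, y, z)) | c x y z. True} \<union>
    {gen (x, scale c y, z) - fscale c (gen (x, y, z)) | c x y z. True} \<union>
    {gen (x, y, scale c z) - fscale c (gen (x, y, z)) | c x y z. True}"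

definition tens_eq3 ::
    "('k::field \<Rightarrow> 'a::ab_group_add \<Rightarrow> 'a) \<Rightarrow> ('a, 'k) formal3 \<Rightarrow> ('a, 'k) formal3 \<Rightarrow> bool"
  where "tens_eq3 scale p q \<longleftrightarrow> p - q \<in> free.span (tens_rels3 scale)"

text \<open>\<open>f \<otimes> g\<close> and \<open>f \<otimes> g \<otimes> h\<close>, for linear \<open>f\<close>, \<open>g\<close>, \<open>h\<close>.\<close>

definition tmap2 :: "('a \<Rightarrow> 'a) \<Rightarrow> ('a \<Rightarrow> 'a) \<Rightarrow> ('a, 'k::field) formal2 \<Rightarrow> ('a, 'k) formal2"
  where "tmap2 f g = lin_ext (\<lambda>(x, y). gen (f x, g y))"

definition tmap3 ::
    "('a \<Rightarrow> 'a) \<Rightarrow> ('a \<Rightarrow> 'a) \<Rightarrow> ('a \<Rightarrow> 'a) \<Rightarrow> ('a, 'k::field) formal3 \<Rightarrow> ('a, 'k) formal3"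
  where "tmap3 f g h = lin_ext (\<lambda>(x, y, z). gen (f x, g y, h z))"

definition tau :: "('a, 'k::field) formal2 \<Rightarrow> ('a, 'k) formal2"
  where "tau = lin_ext (\<lambda>(x, y). gen (y, x))"

text \<open>\<open>\<tau> \<otimes> id\<close> and \<open>id \<otimes> \<tau>\<close>.\<close>

definition tau_id :: "('a, 'k::field) formal3 \<Rightarrow> ('a, 'k) formal3"
  where "tau_id = lin_ext (\<lambda>(x, y, z). gen (y, x, z))"

definition id_tau :: "('a, 'k::field) formal3 \<Rightarrow> ('a, 'k) formal3"
  where "id_tau = lin_ext (\<lambda>(x, y, z). gen (x, z, y))"

text \<open>\<open>\<Delta> \<otimes> id\<close> and \<open>id \<otimes> \<Delta>\<close>, for \<open>\<Delta>\<close> linear modulo \<open>tens_eq2\<close>.\<close>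

definition cop_id ::
    "('a \<Rightarrow> ('a, 'k::field) formal2) \<Rightarrow> ('a, 'k) formal2 \<Rightarrow> ('a, 'k) formal3"
  where "cop_id \<Delta> = lin_ext (\<lambda>(a, b). lin_ext (\<lambda>(x, y). gen (x, y, b)) (\<Delta> a))"

definition id_cop ::
    "('a \<Rightarrow> ('a, 'k::field) formal2) \<Rightarrow> ('a, 'k) formal2 \<Rightarrow> ('a, 'k) formal3"
  where "id_cop \<Delta> = lin_ext (\<lambda>(a, b). lin_ext (\<lambda>(x, y). gen (a, x, y)) (\<Delta> b))"


section \<open>Novikov algebras, coalgebras and bialgebras\<close>

definition star :: "('a \<Rightarrow> 'a \<Rightarrow> 'a::plus) \<Rightarrow> 'a \<Rightarrow> 'a \<Rightarrow> 'a"
  where "star mul a b = mul a b + mul b a"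

definition L :: "('a \<Rightarrow> 'a \<Rightarrow> 'a) \<Rightarrow> 'a \<Rightarrow> 'a \<Rightarrow> 'a"
  where "L mul a b = mul a b"

definition R :: "('a \<Rightarrow> 'a \<Rightarrow> 'a) \<Rightarrow> 'a \<Rightarrow> 'a \<Rightarrow> 'a"
  where "R mul a b = mul b a"

definition Lstar :: "('a \<Rightarrow> 'a \<Rightarrow> 'a::plus) \<Rightarrow> 'a \<Rightarrow> 'a \<Rightarrow> 'a"
  where "Lstar mul a b = L mul a b + R mul a b"

locale novikov_algebra = vector_space scale
  for scale :: "'k::field_char_0 \<Rightarrow> 'a::ab_group_add \<Rightarrow> 'a" +
  fixes mul :: "'a \<Rightarrow> 'a \<Rightarrow> 'a"  (infixl \<open>\<circ>\<^sub>A\<close> 70)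
  assumes linear_left: "Vector_Spaces.linear scale scale (\<lambda>a. a \<circ>\<^sub>A b)"
    and linear_right: "Vector_Spaces.linear scale scale (\<lambda>b. a \<circ>\<^sub>A b)"
    and left_symmetric:
      "(a \<circ>\<^sub>A b) \<circ>\<^sub>A c - a \<circ>\<^sub>A (b \<circ>\<^sub>A c) = (b \<circ>\<^sub>A a) \<circ>\<^sub>A c - b \<circ>\<^sub>A (a \<circ>\<^sub>A c)"
    and right_commutative: "(a \<circ>\<^sub>A b) \<circ>\<^sub>A c = (a \<circ>\<^sub>A c) \<circ>\<^sub>A b"

locale novikov_coalgebra = vector_space scale
  for scale :: "'k::field_char_0 \<Rightarrow> 'a::ab_group_add \<Rightarrow> 'a" +
  fixes \<Delta> :: "'a \<Rightarrow> ('a, 'k) formal2"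
  assumes cop_add: "tens_eq2 scale (\<Delta> (a + b)) (\<Delta> a + \<Delta> b)"
    and cop_scale: "tens_eq2 scale (\<Delta> (scale c a)) (fscale c (\<Delta> a))"
    and co_left_symmetric:
      "tens_eq3 scale
        (id_cop \<Delta> (\<Delta> a) - tau_id (id_cop \<Delta> (\<Delta> a)))
        (cop_id \<Delta> (\<Delta> a) - tau_id (cop_id \<Delta> (\<Delta> a)))"
    and co_right_commutative:
      "tens_eq3 scale (tau_id (id_cop \<Delta> (tau (\<Delta> a)))) (cop_id \<Delta> (\<Delta> a))"

locale novikov_bialgebra = novikov_algebra scale mul + novikov_coalgebra scale \<Delta>
  for scale :: "'k::field_char_0 \<Rightarrow> 'a::ab_group_add \<Rightarrow> 'a"
    and mul :: "'a \<Rightarrow> 'a \<Rightarrow> 'a"  (infixl \<open>\<circ>\<^sub>A\<close> 70)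
    and \<Delta> :: "'a \<Rightarrow> ('a, 'k) formal2" +
  assumes bialgebra_mul:
      "tens_eq2 scale (\<Delta> (a \<circ>\<^sub>A b))
        (tmap2 (R mul b) id (\<Delta> a) + tmap2 id (Lstar mul a) (\<Delta> b + tau (\<Delta> b)))"
    and bialgebra_Lstar:
      "tens_eq2 scale
        (tmap2 (Lstar mul a) id (\<Delta> b) - tmap2 id (Lstar mul a) (tau (\<Delta> b)))
        (tmap2 (Lstar mul b) id (\<Delta> a) - tmap2 id (Lstar mul b) (tau (\<Delta> a)))"
    and bialgebra_R:
      "tens_eq2 scale
        (tmap2 id (R mul a) (\<Delta> b + tau (\<Delta> b)) - tmap2 (R mul a) id (\<Delta> b + tau (\<Delta> b)))
        (tmap2 id (R mul b) (\<Delta> a + tau (\<Delta> a)) - tmap2 (R mul b) id (\<Delta> a + tau (\<Delta> a)))"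


section \<open>The Novikov Yang-Baxter equation\<close>

definition r13_circ_r23 ::
    "('a \<Rightarrow> 'a \<Rightarrow> 'a) \<Rightarrow> ('a, 'k::field) formal2 \<Rightarrow> ('a, 'k) formal3"
  where "r13_circ_r23 mul r =
    lin_ext (\<lambda>(x, y). lin_ext (\<lambda>(x', y'). gen (x, x', mul y y')) r) r"

definition r12_star_r23 ::
    "('a \<Rightarrow> 'a \<Rightarrow> 'a::plus) \<Rightarrow> ('a, 'k::field) formal2 \<Rightarrow> ('a, 'k) formal3"
  where "r12_star_r23 mul r =
    lin_ext (\<lambda>(x, y). lin_ext (\<lambda>(x', y'). gen (x, star mul y x', y')) r) r"

definition r13_circ_r12 ::
    "('a \<Rightarrow> 'a \<Rightarrow> 'a) \<Rightarrow> ('a, 'k::field) formal2 \<Rightarrow> ('a, 'k) formal3"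
  where "r13_circ_r12 mul r =
    lin_ext (\<lambda>(x, y). lin_ext (\<lambda>(x', y'). gen (mul x x', y', y)) r) r"

definition diamond ::
    "('a \<Rightarrow> 'a \<Rightarrow> 'a::plus) \<Rightarrow> ('a, 'k::field) formal2 \<Rightarrow> ('a, 'k) formal3"
  where "diamond mul r = r13_circ_r23 mul r + r12_star_r23 mul r + r13_circ_r12 mul r"

definition NYBE ::
    "('k::field \<Rightarrow> 'a::ab_group_add \<Rightarrow> 'a) \<Rightarrow> ('a \<Rightarrow> 'a \<Rightarrow> 'a) \<Rightarrow> ('a, 'k) formal2 \<Rightarrow> bool"
  where "NYBE scale mul r \<longleftrightarrow> tens_eq3 scale (diamond mul r) 0"

definition skewsymmetric ::
    "('k::field \<Rightarrow> 'a::ab_group_add \<Rightarrow> 'a) \<Rightarrow> ('a, 'k) formal2 \<Rightarrow> bool"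
  where "skewsymmetric scale r \<longleftrightarrow> tens_eq2 scale (tau r) (- r)"

definition Delta_r ::
    "('a \<Rightarrow> 'a \<Rightarrow> 'a::plus) \<Rightarrow> ('a, 'k::field) formal2 \<Rightarrow> 'a \<Rightarrow> ('a, 'k) formal2"
  where "Delta_r mul r a = tmap2 (L mul a) id r + tmap2 id (Lstar mul a) r"

end

theory Submission
  imports Defs
begin

text \<open>
  A tensor over a field is zero as soon as every multilinear form vanishes on it, so each tensor
  identity below is tested on an arbitrary bilinear form \<open>\<beta>\<close> or trilinear form \<open>\<phi>\<close>
  (\<open>tens_eq2_iff\<close>, \<open>tens_eq3_iff\<close>).  Write \<open>r = \<Sum> x \<otimes> y\<close>.  Testing turns an expression with two
  copies of \<open>r\<close> into a sum of terms \<open>rsum2 F = \<Sum>\<Sum> F x y x' y'\<close> with \<open>F\<close> linear in each argument.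
  Interchanging the copies \<open>(x, y)\<close> and \<open>(x', y')\<close> preserves such a term, and by skewsymmetry of
  \<open>r\<close> interchanging the two legs inside one copy changes its sign.

  The three compatibility conditions between product and coproduct always hold for \<open>\<Delta>\<^sub>r\<close>: they are
  linear in \<open>r\<close> and reduce to \<open>(a \<circ> b) \<star> c = a \<star> (c \<circ> b)\<close> and to right commutativity.  So only the two
  coalgebra axioms are left.  Put \<open>D = r \<diamondop> r\<close>.

  For co-right-commutativity, the difference of the two sides is exactly the second tensor of
  the criterion, \<open>(id - id \<otimes> \<tau>)(id \<otimes> id \<otimes> L\<^sub>\<star>(a)) D\<close>.

  For co-left-symmetry, put \<open>E = (id \<otimes> \<Delta>)\<Delta> a - (\<Delta> \<otimes> id)\<Delta> a\<close>, so that the axiom reads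
  \<open>E - (\<tau> \<otimes> id) E = 0\<close>.  As \<open>D\<close> is invariant under interchange of its outer factors
  (\<open>diamond_sym13\<close>), the first tensor of the criterion is likewise of the form \<open>G - (\<tau> \<otimes> id) G\<close>, with
  \<open>G = (L(a) \<otimes> id \<otimes> id)(id \<otimes> \<tau>) D + (id \<otimes> id \<otimes> L\<^sub>\<star>(a)) D\<close>.  Most terms of \<open>E + G\<close> cancel, and what
  remains is visibly invariant under \<open>\<tau> \<otimes> id\<close> (\<open>defect_sum_eq\<close>, \<open>defect_sum_sym\<close>); hence
  \<open>E - (\<tau> \<otimes> id) E = -(G - (\<tau> \<otimes> id) G)\<close>.
\<close>

section \<open>Detecting tensors by multilinear forms\<close>

text \<open>The linear functional on the free vector space that takes the value \<open>f x\<close> at the generator \<open>x\<close>: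
  the scalar counterpart of \<open>lin_ext\<close>.\<close>
definition eval :: "('x \<Rightarrow> 'k::field) \<Rightarrow> ('x \<Rightarrow>\<^sub>0 'k) \<Rightarrow> 'k"
  where "eval f p = (\<Sum>x\<in>Poly_Mapping.keys p. Poly_Mapping.lookup p x * f x)"

lemma eval_superset:
  assumes "finite K" "Poly_Mapping.keys p \<subseteq> K"
  shows "eval f p = (\<Sum>x\<in>K. Poly_Mapping.lookup p x * f x)"
  unfolding eval_def using assms
  by (intro sum.mono_neutral_left) (auto simp: in_keys_iff)

lemma eval_add [simp]: "eval f (p + q) = eval f p + eval f q"
proof -
  let ?K = "Poly_Mapping.keys p \<union> Poly_Mapping.keys q"
  have "eval f (p + q) = (\<Sum>x\<in>?K. Poly_Mapping.lookup (p + q) x * f x)"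
    by (rule eval_superset) (use Poly_Mapping.keys_add[of p q] in auto)
  also have "\<dots> = (\<Sum>x\<in>?K. Poly_Mapping.lookup p x * f x) + (\<Sum>x\<in>?K. Poly_Mapping.lookup q x * f x)"
    by (simp add: lookup_add distrib_right sum.distrib)
  also have "\<dots> = eval f p + eval f q"
    by (simp add: eval_superset[of ?K])
  finally show ?thesis .
qed

lemma eval_fscale [simp]: "eval f (fscale c p) = c * eval f p"
proof -
  have "eval f (fscale c p) = (\<Sum>x\<in>Poly_Mapping.keys p. Poly_Mapping.lookup (fscale c p) x * f x)"
    by (rule eval_superset) (auto simp: in_keys_iff)
  then show ?thesis
    by (simp add: eval_def sum_distrib_left mult.assoc)
qed

lemma eval_zero [simp]: "eval f 0 = 0"
  by (simp add: eval_def)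

lemma eval_uminus [simp]: "eval f (- p) = - eval f p"
  using eval_add[of f p "- p"] by (simp add: eq_neg_iff_add_eq_0 add.commute)

lemma eval_diff [simp]: "eval f (p - q) = eval f p - eval f q"
  using eval_add[of f p "- q"] by simp

lemma eval_sum [simp]: "eval f (sum g A) = (\<Sum>x\<in>A. eval f (g x))"
  by (induction A rule: infinite_finite_induct) auto

lemma eval_gen [simp]: "eval f (gen x) = f x"
  by (simp add: eval_def gen_def)

lemma eval_lin_ext [simp]: "eval f (lin_ext g p) = eval (\<lambda>x. eval f (g x)) p"
  by (simp add: lin_ext_def) (simp add: eval_def)

lemma eval_plus_form: "eval (\<lambda>x. f x + g x) p = eval f p + eval g p"
  by (simp add: eval_def distrib_left sum.distrib)

lemma eval_uminus_form: "eval (\<lambda>x. - f x) p = - eval f p"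
  by (simp add: eval_def sum_negf)

lemma eval_diff_form: "eval (\<lambda>x. f x - g x) p = eval f p - eval g p"
  by (simp add: eval_def right_diff_distrib sum_subtractf)

lemma eval_mult_form: "eval (\<lambda>x. c * f x) p = c * eval f p"
  by (simp add: eval_def sum_distrib_left mult.left_commute)

text \<open>With \<open>p = q = r\<close> this makes the two copies of \<open>r\<close> in a double contraction interchangeable.\<close>
lemma eval_swap: "eval (\<lambda>x. eval (\<lambda>y. f x y) q) p = eval (\<lambda>y. eval (\<lambda>x. f x y) p) q"
  unfolding eval_def sum_distrib_left
  by (subst sum.swap) (simp add: mult.left_commute)

lemma sum_fscale_gen: "(\<Sum>x\<in>Poly_Mapping.keys p. fscale (Poly_Mapping.lookup p x) (gen x)) = p"
proof (rule poly_mapping_eqI)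
  fix y
  have "Poly_Mapping.lookup (\<Sum>x\<in>Poly_Mapping.keys p. fscale (Poly_Mapping.lookup p x) (gen x)) y
      = (\<Sum>x\<in>Poly_Mapping.keys p. if x = y then Poly_Mapping.lookup p x else 0)"
    unfolding lookup_sum by (rule sum.cong) (simp_all add: gen_def lookup_single when_def)
  then show "Poly_Mapping.lookup (\<Sum>x\<in>Poly_Mapping.keys p. fscale (Poly_Mapping.lookup p x) (gen x)) y
      = Poly_Mapping.lookup p y"
    by (simp add: in_keys_iff)
qed

text \<open>
  Every functional on the free vector space is some \<open>eval f\<close>.  If \<open>p\<close> lies outside the span of \<open>S\<close>, then \<open>p\<close>
  can be added to a basis of that span without losing independence, so some functional vanishes on
  \<open>S\<close> and takes the value 1 at \<open>p\<close>.
\<close>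
lemma span_iff_eval:
  fixes S :: "('x \<Rightarrow>\<^sub>0 'k::field) set"
  shows "p \<in> free.span S \<longleftrightarrow> (\<forall>f. (\<forall>s\<in>S. eval f s = 0) \<longrightarrow> eval f p = 0)"
proof
  assume "p \<in> free.span S"
  then show "\<forall>f. (\<forall>s\<in>S. eval f s = 0) \<longrightarrow> eval f p = 0"
    by (induction rule: free.span_induct_alt) auto
next
  assume annihilated: "\<forall>f. (\<forall>s\<in>S. eval f s = 0) \<longrightarrow> eval f p = 0"
  interpret functional: vector_space_pair "fscale :: 'k \<Rightarrow> ('x \<Rightarrow>\<^sub>0 'k) \<Rightarrow> _" "(*) :: 'k \<Rightarrow> 'k \<Rightarrow> 'k"
    by standard (auto simp: algebra_simps)
  show "p \<in> free.span S"
  proof (rule ccontr)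
    assume outside: "p \<notin> free.span S"
    obtain B where B: "B \<subseteq> S" "free.independent B" "S \<subseteq> free.span B"
      using free.maximal_independent_subset by blast
    have "p \<notin> free.span B"
      using outside B(1) free.span_mono by blast
    then have "free.independent (insert p B)"
      using B(2) free.independent_insertI by blast
    from functional.linear_independent_extend[OF this, of "\<lambda>x. if x = p then 1 else 0"]
    obtain g where g: "Vector_Spaces.linear fscale (*) g"
      and on_B: "\<forall>x\<in>insert p B. g x = (if x = p then 1 else 0)"
      by blast
    have g_eval: "eval (\<lambda>x. g (gen x)) q = g q" for q
    proof -
      have "g q = g (\<Sum>x\<in>Poly_Mapping.keys q. fscale (Poly_Mapping.lookup q x) (gen x))"
        by (simp add: sum_fscale_gen)
      also have "\<dots> = eval (\<lambda>x. g (gen x)) q"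
        using g by (simp add: functional.linear_sum functional.linear_scale eval_def)
      finally show ?thesis by simp
    qed
    have "g s = 0" if "s \<in> S" for s
    proof (rule functional.linear_eq_0_on_span[OF g])
      show "s \<in> free.span B" using that B(3) by blast
      show "g b = 0" if "b \<in> B" for b
        using that on_B \<open>p \<notin> free.span B\<close> free.span_base by auto
    qed
    then have "g p = 0"
      using annihilated[rule_format, of "\<lambda>x. g (gen x)"] by (simp add: g_eval)
    with on_B show False by simp
  qed
qed

definition linear_form :: "('k::field \<Rightarrow> 'a::ab_group_add \<Rightarrow> 'a) \<Rightarrow> ('a \<Rightarrow> 'k) \<Rightarrow> bool"
  where "linear_form scale f \<longleftrightarrow>
    (\<forall>x y. f (x + y) = f x + f y) \<and> (\<forall>c x. f (scale c x) = c * f x)"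

definition bilinear_form :: "('k::field \<Rightarrow> 'a::ab_group_add \<Rightarrow> 'a) \<Rightarrow> ('a \<Rightarrow> 'a \<Rightarrow> 'k) \<Rightarrow> bool"
  where "bilinear_form scale \<beta> \<longleftrightarrow>
    (\<forall>y. linear_form scale (\<lambda>x. \<beta> x y)) \<and> (\<forall>x. linear_form scale (\<lambda>y. \<beta> x y))"

definition trilinear_form :: "('k::field \<Rightarrow> 'a::ab_group_add \<Rightarrow> 'a) \<Rightarrow> ('a \<Rightarrow> 'a \<Rightarrow> 'a \<Rightarrow> 'k) \<Rightarrow> bool"
  where "trilinear_form scale \<phi> \<longleftrightarrow> (\<forall>y z. linear_form scale (\<lambda>x. \<phi> x y z)) \<and>
    (\<forall>x z. linear_form scale (\<lambda>y. \<phi> x y z)) \<and> (\<forall>x y. linear_form scale (\<lambda>z. \<phi> x y z))"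

lemmas multilinear_defs = linear_form_def bilinear_form_def trilinear_form_def

lemma trilinear_simps:
  assumes "trilinear_form scale \<phi>"
  shows "\<phi> (x + y) z w = \<phi> x z w + \<phi> y z w" "\<phi> z (x + y) w = \<phi> z x w + \<phi> z y w"
    "\<phi> z w (x + y) = \<phi> z w x + \<phi> z w y"
    "\<phi> (scale c x) z w = c * \<phi> x z w" "\<phi> z (scale c x) w = c * \<phi> z x w"
    "\<phi> z w (scale c x) = c * \<phi> z w x"
  using assms by (simp_all add: multilinear_defs)

lemma trilinear_diff:
  assumes "trilinear_form scale \<phi>"
  shows "\<phi> (x - y) z w = \<phi> x z w - \<phi> y z w" "\<phi> z (x - y) w = \<phi> z x w - \<phi> z y w"
    "\<phi> z w (x - y) = \<phi> z w x - \<phi> z w y"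
  using trilinear_simps(1)[OF assms, of "x - y" y z w] trilinear_simps(2)[OF assms, of z "x - y" y w]
    trilinear_simps(3)[OF assms, of z w "x - y" y]
  by simp_all

abbreviation eval2 :: "('a \<Rightarrow> 'a \<Rightarrow> 'k::field) \<Rightarrow> ('a, 'k) formal2 \<Rightarrow> 'k"
  where "eval2 \<beta> \<equiv> eval (\<lambda>(x, y). \<beta> x y)"

abbreviation eval3 :: "('a \<Rightarrow> 'a \<Rightarrow> 'a \<Rightarrow> 'k::field) \<Rightarrow> ('a, 'k) formal3 \<Rightarrow> 'k"
  where "eval3 \<phi> \<equiv> eval (\<lambda>(x, y, z). \<phi> x y z)"

lemma ball_ternary_image: "(\<forall>s\<in>{g x y z |x y z. True}. P s) \<longleftrightarrow> (\<forall>x y z. P (g x y z))"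
  by blast

lemma ball_quaternary_image:
  "(\<forall>s\<in>{g w x y z |w x y z. True}. P s) \<longleftrightarrow> (\<forall>w x y z. P (g w x y z))"
  by blast

text \<open>A functional \<open>eval f\<close> kills the defining relations of the tensor product exactly if \<open>f\<close> is
  multilinear, so \<open>span_iff_eval\<close> becomes a test of tensor equality by multilinear forms.\<close>
lemma tens_eq2_iff:
  fixes scale :: "'k::field \<Rightarrow> 'a::ab_group_add \<Rightarrow> 'a"
  shows "tens_eq2 scale p q \<longleftrightarrow> (\<forall>\<beta>. bilinear_form scale \<beta> \<longrightarrow> eval2 \<beta> p = eval2 \<beta> q)"
proof -
  have "(\<forall>s\<in>tens_rels2 scale. eval f s = 0) \<longleftrightarrow> bilinear_form scale (curry f)"
    for f :: "'a \<times> 'a \<Rightarrow> 'k"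
    unfolding tens_rels2_def ball_Un ball_ternary_image ball_quaternary_image multilinear_defs
      eval_diff eval_gen eval_fscale diff_diff_eq right_minus_eq curry_conv
    by (intro iffI conjI allI; elim conjE; simp)
  then have "tens_eq2 scale p q \<longleftrightarrow>
      (\<forall>f. bilinear_form scale (curry f) \<longrightarrow> eval f p = eval f q)"
    by (simp add: tens_eq2_def span_iff_eval)
  then show ?thesis
    by (metis curry_case_prod case_prod_curry)
qed

lemma tens_eq3_iff:
  fixes scale :: "'k::field \<Rightarrow> 'a::ab_group_add \<Rightarrow> 'a"
  shows "tens_eq3 scale p q \<longleftrightarrow> (\<forall>\<phi>. trilinear_form scale \<phi> \<longrightarrow> eval3 \<phi> p = eval3 \<phi> q)"
proof -
  have "(\<forall>s\<in>tens_rels3 scale. eval f s = 0) \<longleftrightarrow> trilinear_form scale (\<lambda>x y z. f (x, y, z))"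
    for f :: "'a \<times> 'a \<times> 'a \<Rightarrow> 'k"
    unfolding tens_rels3_def ball_Un ball_ternary_image ball_quaternary_image multilinear_defs
      eval_diff eval_gen eval_fscale diff_diff_eq right_minus_eq curry_conv
    by (intro iffI conjI allI; elim conjE; simp)
  then have iff: "tens_eq3 scale p q \<longleftrightarrow>
      (\<forall>f. trilinear_form scale (\<lambda>x y z. f (x, y, z)) \<longrightarrow> eval f p = eval f q)"
    by (simp add: tens_eq3_def span_iff_eval)
  show ?thesis
  proof
    assume "tens_eq3 scale p q"
    then show "\<forall>\<phi>. trilinear_form scale \<phi> \<longrightarrow> eval3 \<phi> p = eval3 \<phi> q"
      unfolding iff by auto
  next
    assume R: "\<forall>\<phi>. trilinear_form scale \<phi> \<longrightarrow> eval3 \<phi> p = eval3 \<phi> q"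
    show "tens_eq3 scale p q"
      unfolding iff
    proof (intro allI impI)
      fix f assume "trilinear_form scale (\<lambda>x y z. f (x, y, z))"
      with R have "eval3 (\<lambda>x y z. f (x, y, z)) p = eval3 (\<lambda>x y z. f (x, y, z)) q"
        by blast
      then show "eval f p = eval f q" by simp
    qed
  qed
qed

lemma eval2_tau: "eval2 \<beta> (tau p) = eval2 (\<lambda>x y. \<beta> y x) p"
  by (simp add: tau_def case_prod_beta')

lemma eval2_tmap2: "eval2 \<beta> (tmap2 f g p) = eval2 (\<lambda>x y. \<beta> (f x) (g y)) p"
  by (simp add: tmap2_def case_prod_beta')

lemma eval3_tau_id: "eval3 \<phi> (tau_id p) = eval3 (\<lambda>x y z. \<phi> y x z) p"
  by (simp add: tau_id_def case_prod_beta')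

lemma eval3_id_tau: "eval3 \<phi> (id_tau p) = eval3 (\<lambda>x y z. \<phi> x z y) p"
  by (simp add: id_tau_def case_prod_beta')

lemma eval3_tmap3: "eval3 \<phi> (tmap3 f g h p) = eval3 (\<lambda>x y z. \<phi> (f x) (g y) (h z)) p"
  by (simp add: tmap3_def case_prod_beta')

lemma eval3_id_cop: "eval3 \<phi> (id_cop \<Delta> p) = eval2 (\<lambda>u v. eval2 (\<lambda>x y. \<phi> u x y) (\<Delta> v)) p"
  by (simp add: id_cop_def case_prod_beta')

lemma eval3_cop_id: "eval3 \<phi> (cop_id \<Delta> p) = eval2 (\<lambda>u v. eval2 (\<lambda>x y. \<phi> x y v) (\<Delta> u)) p"
  by (simp add: cop_id_def case_prod_beta')

section \<open>Identities in a Novikov algebra\<close>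

context novikov_algebra
begin

abbreviation star_A :: "'a \<Rightarrow> 'a \<Rightarrow> 'a"  (infixl \<open>\<star>\<close> 70)
  where "a \<star> b \<equiv> star mul a b"

lemma star_commute: "a \<star> b = b \<star> a"
  by (simp add: star_def add.commute)

lemma Lstar_eq_star: "Lstar mul a = star mul a"
  by (rule ext) (simp add: Lstar_def star_def L_def R_def)

lemma mul_linear:
  "(a + b) \<circ>\<^sub>A c = a \<circ>\<^sub>A c + b \<circ>\<^sub>A c" "a \<circ>\<^sub>A (b + c) = a \<circ>\<^sub>A b + a \<circ>\<^sub>A c"
  "scale k a \<circ>\<^sub>A b = scale k (a \<circ>\<^sub>A b)" "a \<circ>\<^sub>A scale k b = scale k (a \<circ>\<^sub>A b)"
  using linear_left linear_right
  by (auto simp: Vector_Spaces.linear_iff)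

lemma star_linear:
  "(a + b) \<star> c = a \<star> c + b \<star> c" "a \<star> (b + c) = a \<star> b + a \<star> c"
  "scale k a \<star> b = scale k (a \<star> b)" "a \<star> scale k b = scale k (a \<star> b)"
  by (simp_all add: star_def mul_linear scale_right_distrib)

text \<open>Up to right commutativity this is left symmetry for \<open>a, c, b\<close>.\<close>
lemma mul_star: "(a \<circ>\<^sub>A b) \<star> c = a \<star> (c \<circ>\<^sub>A b)"
  using left_symmetric[of a c b] right_commutative[of a b c] right_commutative[of c a b]
  by (simp add: star_def algebra_simps)

definition associator :: "'a \<Rightarrow> 'a \<Rightarrow> 'a \<Rightarrow> 'a"
  where "associator a b c = (a \<circ>\<^sub>A b) \<circ>\<^sub>A c - a \<circ>\<^sub>A (b \<circ>\<^sub>A c)"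

lemma star_mul_minus_mul_star: "(a \<star> y) \<circ>\<^sub>A x - (a \<circ>\<^sub>A x) \<star> y = associator a y x"
  using left_symmetric[of a y x] right_commutative[of a y x]
  by (simp add: star_def associator_def mul_linear algebra_simps)

text \<open>By \<open>mul_star\<close> the second summand is \<open>(a \<circ> z) \<star> y\<close>, and \<open>(y \<circ> a) \<star> z = y \<star> (z \<circ> a) = (z \<circ> a) \<star> y\<close>.\<close>
lemma star_star_plus_star_mul_commute:
  "(a \<star> y) \<star> z + a \<star> (y \<circ>\<^sub>A z) = (a \<star> z) \<star> y + a \<star> (z \<circ>\<^sub>A y)"
proof -
  have "(y \<circ>\<^sub>A a) \<star> z = (z \<circ>\<^sub>A a) \<star> y"
    by (metis mul_star star_commute)
  then show ?thesis
    by (simp add: star_def[of mul a] star_linear flip: mul_star)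
qed

lemma Lstar_exchange: "a \<star> (b \<circ>\<^sub>A x) = b \<star> (a \<circ>\<^sub>A x)"
  by (metis mul_star star_commute)

end

section \<open>Contraction with a skewsymmetric tensor\<close>

locale novikov_skew_tensor = novikov_algebra scale mul
  for scale :: "'k::field_char_0 \<Rightarrow> 'a::ab_group_add \<Rightarrow> 'a"
    and mul :: "'a \<Rightarrow> 'a \<Rightarrow> 'a"  (infixl \<open>\<circ>\<^sub>A\<close> 70) +
  fixes r :: "('a, 'k) formal2"
  assumes skew: "skewsymmetric scale r"
begin

definition rsum :: "('a \<Rightarrow> 'a \<Rightarrow> 'k) \<Rightarrow> 'k"
  where "rsum \<beta> = eval2 \<beta> r"

definition rsum2 :: "('a \<Rightarrow> 'a \<Rightarrow> 'a \<Rightarrow> 'a \<Rightarrow> 'k) \<Rightarrow> 'k"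
  where "rsum2 F = rsum (\<lambda>x y. rsum (\<lambda>x' y'. F x y x' y'))"

lemma rsum_add: "rsum (\<lambda>x y. \<beta> x y + \<gamma> x y) = rsum \<beta> + rsum \<gamma>"
  by (simp add: rsum_def case_prod_beta' eval_plus_form)

lemma rsum_diff: "rsum (\<lambda>x y. \<beta> x y - \<gamma> x y) = rsum \<beta> - rsum \<gamma>"
  by (simp add: rsum_def case_prod_beta' eval_diff_form)

lemma rsum_uminus: "rsum (\<lambda>x y. - \<beta> x y) = - rsum \<beta>"
  by (simp add: rsum_def case_prod_beta' eval_uminus_form)

lemma rsum_mult: "rsum (\<lambda>x y. c * \<beta> x y) = c * rsum \<beta>"
  by (simp add: rsum_def case_prod_beta' eval_mult_form)

text \<open>Skewsymmetry of \<open>r\<close>, seen by a bilinear form.\<close>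
lemma rsum_flip:
  assumes "bilinear_form scale \<beta>"
  shows "rsum (\<lambda>x y. \<beta> y x) = - rsum \<beta>"
proof -
  have "eval2 \<beta> (tau r) = eval2 \<beta> (- r)"
    using skew assms by (simp add: skewsymmetric_def tens_eq2_iff)
  then show ?thesis
    by (simp add: rsum_def eval2_tau)
qed

lemma rsum2_add: "rsum2 (\<lambda>x y x' y'. F x y x' y' + G x y x' y') = rsum2 F + rsum2 G"
  by (simp add: rsum2_def rsum_add)

lemma rsum2_diff: "rsum2 (\<lambda>x y x' y'. F x y x' y' - G x y x' y') = rsum2 F - rsum2 G"
  by (simp add: rsum2_def rsum_diff)

lemma rsum2_swap: "rsum2 (\<lambda>x y x' y'. F x' y' x y) = rsum2 F"
  unfolding rsum2_def rsum_def case_prod_beta' by (rule eval_swap)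

lemma rsum2_flip_right:
  assumes "\<And>x y. bilinear_form scale (F x y)"
  shows "rsum2 (\<lambda>x y x' y'. F x y y' x') = - rsum2 F"
  using assms by (simp add: rsum2_def rsum_flip rsum_uminus)

lemma rsum2_flip_left:
  assumes "\<And>x' y'. bilinear_form scale (\<lambda>x y. F x y x' y')"
  shows "rsum2 (\<lambda>x y x' y'. F y x x' y') = - rsum2 F"
proof -
  have "rsum2 (\<lambda>x y x' y'. F y x x' y') = rsum2 (\<lambda>x y x' y'. F y' x' x y)"
    by (rule rsum2_swap[of "\<lambda>x y x' y'. F y x x' y'", symmetric])
  also have "\<dots> = - rsum2 (\<lambda>x y x' y'. F x' y' x y)"
    by (rule rsum2_flip_right) (use assms in simp)
  finally show ?thesis by (simp add: rsum2_swap[of F])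
qed

lemma rsum2_flip_both:
  assumes "\<And>x y. bilinear_form scale (F x y)" "\<And>x' y'. bilinear_form scale (\<lambda>x y. F x y x' y')"
  shows "rsum2 (\<lambda>x y x' y'. F y x y' x') = rsum2 F"
  using rsum2_flip_right[of "\<lambda>x y. F y x"] rsum2_flip_left[of F] assms by simp

lemma eval2_Delta_r:
  "eval2 \<beta> (Delta_r mul r a) = rsum (\<lambda>x y. \<beta> (a \<circ>\<^sub>A x) y) + rsum (\<lambda>x y. \<beta> x (a \<star> y))"
  by (simp add: Delta_r_def eval2_tmap2 rsum_def Lstar_eq_star L_def)

text \<open>In \<open>\<Delta>\<^sub>r(a) + \<tau>\<Delta>\<^sub>r(a)\<close> skewsymmetry cancels all terms with \<open>a\<close> on the left, leaving
  \<open>(id \<otimes> R(a) - R(a) \<otimes> id) r\<close>.\<close>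
lemma eval2_Delta_r_sym:
  assumes "bilinear_form scale \<beta>"
  shows "eval2 \<beta> (Delta_r mul r a) + eval2 (\<lambda>x y. \<beta> y x) (Delta_r mul r a)
    = rsum (\<lambda>x y. \<beta> x (y \<circ>\<^sub>A a)) - rsum (\<lambda>x y. \<beta> (x \<circ>\<^sub>A a) y)"
proof -
  have "rsum (\<lambda>x y. \<beta> y (a \<circ>\<^sub>A x)) = - rsum (\<lambda>x y. \<beta> x (a \<circ>\<^sub>A y))"
    "rsum (\<lambda>x y. \<beta> (a \<star> y) x) = - rsum (\<lambda>x y. \<beta> (a \<star> x) y)"
    using assms
    by (intro rsum_flip; simp add: multilinear_defs mul_linear star_linear)+
  then show ?thesis
    using assms
    by (simp add: eval2_Delta_r star_def multilinear_defs rsum_add)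
qed

section \<open>The coalgebra axioms\<close>

lemma eval3_diamond:
  "eval3 \<phi> (diamond mul r) = rsum2 (\<lambda>x y x' y'. \<phi> x x' (y \<circ>\<^sub>A y'))
    + rsum2 (\<lambda>x y x' y'. \<phi> x (y \<star> x') y') + rsum2 (\<lambda>x y x' y'. \<phi> (x \<circ>\<^sub>A x') y' y)"
  by (simp add: diamond_def r13_circ_r23_def r12_star_r23_def r13_circ_r12_def
      rsum2_def rsum_def case_prod_beta')

text \<open>Interchanging the outer factors swaps \<open>r\<^sub>1\<^sub>3 \<circ> r\<^sub>2\<^sub>3\<close> with \<open>r\<^sub>1\<^sub>3 \<circ> r\<^sub>1\<^sub>2\<close> and fixes \<open>r\<^sub>1\<^sub>2 \<star> r\<^sub>2\<^sub>3\<close>, in each case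
  after flipping both copies of \<open>r\<close>, where the two signs cancel; in the last case the copies also trade
  places.\<close>
lemma diamond_sym13:
  assumes \<phi>: "trilinear_form scale \<phi>"
  shows "eval3 (\<lambda>p q s. \<phi> s q p) (diamond mul r) = eval3 \<phi> (diamond mul r)"
proof -
  have "rsum2 (\<lambda>x y x' y'. \<phi> (y \<circ>\<^sub>A y') x' x) = rsum2 (\<lambda>x y x' y'. \<phi> (x \<circ>\<^sub>A x') y' y)"
    by (rule rsum2_flip_both)
      (simp_all add: multilinear_defs mul_linear trilinear_simps[OF \<phi>])
  moreover have "rsum2 (\<lambda>x y x' y'. \<phi> y y' (x \<circ>\<^sub>A x')) = rsum2 (\<lambda>x y x' y'. \<phi> x x' (y \<circ>\<^sub>A y'))"
    by (rule rsum2_flip_both)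
      (simp_all add: multilinear_defs mul_linear trilinear_simps[OF \<phi>])
  moreover have "rsum2 (\<lambda>x y x' y'. \<phi> y' (y \<star> x') x) = rsum2 (\<lambda>x y x' y'. \<phi> x (y \<star> x') y')"
  proof -
    have "rsum2 (\<lambda>x y x' y'. \<phi> y' (y \<star> x') x) = rsum2 (\<lambda>x y x' y'. \<phi> y (y' \<star> x) x')"
      by (rule rsum2_swap[of "\<lambda>x y x' y'. \<phi> y' (y \<star> x') x", symmetric])
    also have "\<dots> = rsum2 (\<lambda>x y x' y'. \<phi> x (x' \<star> y) y')"
      by (rule rsum2_flip_both)
        (simp_all add: multilinear_defs star_linear trilinear_simps[OF \<phi>])
    finally show ?thesis by (simp add: star_commute)
  qed
  ultimately show ?thesis
    by (simp add: eval3_diamond)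
qed

abbreviation \<Delta> :: "'a \<Rightarrow> ('a, 'k) formal2"
  where "\<Delta> \<equiv> Delta_r mul r"

abbreviation D :: "('a, 'k) formal3"
  where "D \<equiv> diamond mul r"

lemma eval3_id_cop_Delta_r:
  "eval3 \<phi> (id_cop \<Delta> (\<Delta> a)) =
    rsum2 (\<lambda>x y x' y'. \<phi> (a \<circ>\<^sub>A x) (y \<circ>\<^sub>A x') y') + rsum2 (\<lambda>x y x' y'. \<phi> (a \<circ>\<^sub>A x) x' (y \<star> y'))
    + rsum2 (\<lambda>x y x' y'. \<phi> x ((a \<star> y) \<circ>\<^sub>A x') y') + rsum2 (\<lambda>x y x' y'. \<phi> x x' ((a \<star> y) \<star> y'))"
  by (simp add: eval3_id_cop eval2_Delta_r rsum2_def rsum_add)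

lemma eval3_cop_id_Delta_r:
  "eval3 \<phi> (cop_id \<Delta> (\<Delta> a)) =
    rsum2 (\<lambda>x y x' y'. \<phi> ((a \<circ>\<^sub>A x) \<circ>\<^sub>A x') y' y) + rsum2 (\<lambda>x y x' y'. \<phi> x' ((a \<circ>\<^sub>A x) \<star> y') y)
    + rsum2 (\<lambda>x y x' y'. \<phi> (x \<circ>\<^sub>A x') y' (a \<star> y)) + rsum2 (\<lambda>x y x' y'. \<phi> x' (x \<star> y') (a \<star> y))"
  by (simp add: eval3_cop_id eval2_Delta_r rsum2_def rsum_add)

lemma eval3_id_cop_tau_Delta_r:
  "eval3 \<phi> (id_cop \<Delta> (tau (\<Delta> a))) =
    rsum2 (\<lambda>x y x' y'. \<phi> y ((a \<circ>\<^sub>A x) \<circ>\<^sub>A x') y') + rsum2 (\<lambda>x y x' y'. \<phi> y x' ((a \<circ>\<^sub>A x) \<star> y'))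
    + rsum2 (\<lambda>x y x' y'. \<phi> (a \<star> y) (x \<circ>\<^sub>A x') y') + rsum2 (\<lambda>x y x' y'. \<phi> (a \<star> y) x' (x \<star> y'))"
  by (simp add: eval3_id_cop eval2_tau eval2_Delta_r rsum2_def rsum_add)

text \<open>The tensor \<open>G\<close> whose antisymmetrization in the first two factors is the first tensor of the
  criterion.\<close>
definition left_defect :: "'a \<Rightarrow> ('a, 'k) formal3"
  where "left_defect a = tmap3 (L mul a) id id (id_tau D) + tmap3 id id (Lstar mul a) D"

text \<open>The value of \<open>\<phi>\<close> on \<open>E + G\<close>, where \<open>E\<close> is the tensor whose antisymmetrization in the first two
  factors expresses co-left-symmetry.\<close>
definition defect_sum :: "('a \<Rightarrow> 'a \<Rightarrow> 'a \<Rightarrow> 'k) \<Rightarrow> 'a \<Rightarrow> 'k"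
  where "defect_sum \<phi> a =
    eval3 \<phi> (id_cop \<Delta> (\<Delta> a)) - eval3 \<phi> (cop_id \<Delta> (\<Delta> a)) + eval3 \<phi> (left_defect a)"

lemma eval3_left_defect:
  "eval3 \<phi> (left_defect a) =
      rsum2 (\<lambda>x y x' y'. \<phi> (a \<circ>\<^sub>A x) (y \<circ>\<^sub>A y') x') + rsum2 (\<lambda>x y x' y'. \<phi> (a \<circ>\<^sub>A x) y' (y \<star> x'))
      + rsum2 (\<lambda>x y x' y'. \<phi> (a \<circ>\<^sub>A (x \<circ>\<^sub>A x')) y y')
      + rsum2 (\<lambda>x y x' y'. \<phi> x x' (a \<star> (y \<circ>\<^sub>A y'))) + rsum2 (\<lambda>x y x' y'. \<phi> x (y \<star> x') (a \<star> y'))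
      + rsum2 (\<lambda>x y x' y'. \<phi> (x \<circ>\<^sub>A x') y' (a \<star> y))"
  by (simp add: left_defect_def eval3_tmap3 eval3_id_tau L_def Lstar_eq_star eval3_diamond)

text \<open>
  The terms of \<open>E\<close> with no product of three elements cancel against terms of \<open>G\<close>.  Of the others,
  those with a triple product in the second factor combine to an associator, likewise those in the
  first factor, and the two sums are mirror images of each other.
\<close>
lemma defect_sum_eq:
  assumes \<phi>: "trilinear_form scale \<phi>"
  shows "defect_sum \<phi> a = rsum2 (\<lambda>x y x' y'. \<phi> x x' ((a \<star> y) \<star> y' + a \<star> (y \<circ>\<^sub>A y')))
    + rsum2 (\<lambda>x y x' y'. \<phi> x (associator a y x') y') + rsum2 (\<lambda>x y x' y'. \<phi> (associator a y x') x y')"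
proof -
  note bilin = multilinear_defs mul_linear star_linear trilinear_simps[OF \<phi>]
  have "rsum2 (\<lambda>x y x' y'. \<phi> (a \<circ>\<^sub>A x) (y \<circ>\<^sub>A y') x') = - rsum2 (\<lambda>x y x' y'. \<phi> (a \<circ>\<^sub>A x) (y \<circ>\<^sub>A x') y')"
    by (rule rsum2_flip_right) (simp add: bilin)
  moreover have "rsum2 (\<lambda>x y x' y'. \<phi> (a \<circ>\<^sub>A x) y' (y \<star> x')) = - rsum2 (\<lambda>x y x' y'. \<phi> (a \<circ>\<^sub>A x) x' (y \<star> y'))"
    by (rule rsum2_flip_right) (simp add: bilin)
  moreover have "rsum2 (\<lambda>x y x' y'. \<phi> x' (x \<star> y') (a \<star> y)) = rsum2 (\<lambda>x y x' y'. \<phi> x (y \<star> x') (a \<star> y'))"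
    using rsum2_swap[of "\<lambda>x y x' y'. \<phi> x (y \<star> x') (a \<star> y')"] by (simp add: star_commute)
  moreover have "rsum2 (\<lambda>x y x' y'. \<phi> x ((a \<star> y) \<circ>\<^sub>A x') y') - rsum2 (\<lambda>x y x' y'. \<phi> x' ((a \<circ>\<^sub>A x) \<star> y') y)
    = rsum2 (\<lambda>x y x' y'. \<phi> x (associator a y x') y')"
    using rsum2_swap[of "\<lambda>x y x' y'. \<phi> x ((a \<circ>\<^sub>A x') \<star> y) y'"]
    by (simp add: trilinear_diff[OF \<phi>] rsum2_diff flip: star_mul_minus_mul_star)
  moreover have "rsum2 (\<lambda>x y x' y'. \<phi> (a \<circ>\<^sub>A (x \<circ>\<^sub>A x')) y y') - rsum2 (\<lambda>x y x' y'. \<phi> ((a \<circ>\<^sub>A x) \<circ>\<^sub>A x') y' y)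
    = rsum2 (\<lambda>x y x' y'. \<phi> (associator a y x') x y')"
  proof -
    have "rsum2 (\<lambda>x y x' y'. \<phi> ((a \<circ>\<^sub>A x) \<circ>\<^sub>A x') y' y) = rsum2 (\<lambda>x y x' y'. \<phi> ((a \<circ>\<^sub>A x) \<circ>\<^sub>A x') y y')"
      using rsum2_swap[of "\<lambda>x y x' y'. \<phi> ((a \<circ>\<^sub>A x') \<circ>\<^sub>A x) y y'"]
      by (simp add: right_commutative[of a])
    moreover have "rsum2 (\<lambda>x y x' y'. \<phi> (associator a y x') x y')
      = - rsum2 (\<lambda>x y x' y'. \<phi> (associator a x x') y y')"
      by (rule rsum2_flip_left) (simp add: associator_def bilin trilinear_diff[OF \<phi>] algebra_simps)
    ultimately show ?thesis
      by (simp add: associator_def trilinear_diff[OF \<phi>] rsum2_diff)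
  qed
  ultimately show ?thesis
    unfolding defect_sum_def eval3_id_cop_Delta_r eval3_cop_id_Delta_r eval3_left_defect
    by (simp add: trilinear_simps[OF \<phi>] rsum2_add algebra_simps)
qed

text \<open>The two associator sums are interchanged.  In the remaining sum, exchanging the two copies of \<open>r\<close>
  moves the interchange to the arguments of a symmetric expression in the third factor.\<close>
lemma defect_sum_sym:
  assumes \<phi>: "trilinear_form scale \<phi>"
  shows "defect_sum (\<lambda>p q s. \<phi> q p s) a = defect_sum \<phi> a"
proof -
  have \<phi>': "trilinear_form scale (\<lambda>p q s. \<phi> q p s)"
    using \<phi> by (simp add: trilinear_form_def)
  have "rsum2 (\<lambda>x y x' y'. \<phi> x' x ((a \<star> y) \<star> y' + a \<star> (y \<circ>\<^sub>A y')))
    = rsum2 (\<lambda>x y x' y'. \<phi> x x' ((a \<star> y) \<star> y' + a \<star> (y \<circ>\<^sub>A y')))"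
    by (subst star_star_plus_star_mul_commute) (rule rsum2_swap)
  then show ?thesis
    by (simp add: defect_sum_eq[OF \<phi>] defect_sum_eq[OF \<phi>'])
qed

lemma co_left_symmetric_iff:
  "tens_eq3 scale (id_cop \<Delta> (\<Delta> a) - tau_id (id_cop \<Delta> (\<Delta> a))) (cop_id \<Delta> (\<Delta> a) - tau_id (cop_id \<Delta> (\<Delta> a)))
   \<longleftrightarrow> tens_eq3 scale
      (tmap3 (L mul a) id id (id_tau D) - tmap3 id (L mul a) id (id_tau D)
        + tmap3 id id (Lstar mul a) (D - tau_id D)) 0"
  (is "tens_eq3 scale ?lhs1 ?lhs2 \<longleftrightarrow> tens_eq3 scale ?rhs 0")
proof -
  have "eval3 \<phi> ?lhs1 - eval3 \<phi> ?lhs2 = - eval3 \<phi> ?rhs" if \<phi>: "trilinear_form scale \<phi>" for \<phi>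
  proof -
    \<comment> \<open>The summand with \<open>L(a)\<close> in the second factor is the image under \<open>\<tau> \<otimes> id\<close> of the one in \<open>G\<close>
      only up to the outer symmetry of \<open>D\<close>.\<close>
    have "eval3 (\<lambda>p q s. \<phi> p (a \<circ>\<^sub>A s) q) D = eval3 (\<lambda>p q s. \<phi> s (a \<circ>\<^sub>A p) q) D"
      by (rule diamond_sym13[of "\<lambda>p q s. \<phi> s (a \<circ>\<^sub>A p) q"])
        (simp add: multilinear_defs mul_linear trilinear_simps[OF \<phi>])
    then have "eval3 \<phi> ?rhs = eval3 \<phi> (left_defect a) - eval3 (\<lambda>p q s. \<phi> q p s) (left_defect a)"
      by (simp add: left_defect_def eval3_tmap3 eval3_id_tau eval3_tau_id L_def Lstar_eq_star)
    moreover have "eval3 \<phi> ?lhs1 - eval3 \<phi> ?lhs2 = (defect_sum \<phi> a - eval3 \<phi> (left_defect a))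
        - (defect_sum (\<lambda>p q s. \<phi> q p s) a - eval3 (\<lambda>p q s. \<phi> q p s) (left_defect a))"
      by (simp add: defect_sum_def eval3_tau_id)
    ultimately show ?thesis
      by (simp add: defect_sum_sym[OF \<phi>])
  qed
  then have "eval3 \<phi> ?lhs1 = eval3 \<phi> ?lhs2 \<longleftrightarrow> eval3 \<phi> ?rhs = 0" if "trilinear_form scale \<phi>" for \<phi>
    using that by (metis right_minus_eq neg_equal_0_iff_equal)
  then show ?thesis
    by (simp add: tens_eq3_iff del: eval_diff eval_add)
qed

text \<open>
  The terms with a triple product in the first factor agree by right commutativity.  Those with one
  in the second or third factor are rewritten by \<open>mul_star\<close>; after one flip they become the terms of
  \<open>(id \<otimes> id \<otimes> L\<^sub>\<star>(a)) (r\<^sub>1\<^sub>3 \<circ> r\<^sub>2\<^sub>3)\<close> and its image under \<open>id \<otimes> \<tau>\<close>.  The others match term by term.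
\<close>
lemma co_right_commutative_iff:
  "tens_eq3 scale (tau_id (id_cop \<Delta> (tau (\<Delta> a)))) (cop_id \<Delta> (\<Delta> a))
   \<longleftrightarrow> tens_eq3 scale (tmap3 id id (Lstar mul a) D - id_tau (tmap3 id id (Lstar mul a) D)) 0"
  (is "tens_eq3 scale ?lhs1 ?lhs2 \<longleftrightarrow> tens_eq3 scale ?rhs 0")
proof -
  have "eval3 \<phi> ?lhs2 - eval3 \<phi> ?lhs1 = eval3 \<phi> ?rhs" if \<phi>: "trilinear_form scale \<phi>" for \<phi>
  proof -
    note bilin = multilinear_defs mul_linear star_linear trilinear_simps[OF \<phi>]
    have rhs: "eval3 \<phi> ?rhs =
        rsum2 (\<lambda>x y x' y'. \<phi> x x' (a \<star> (y \<circ>\<^sub>A y'))) + rsum2 (\<lambda>x y x' y'. \<phi> x (y \<star> x') (a \<star> y'))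
        + rsum2 (\<lambda>x y x' y'. \<phi> (x \<circ>\<^sub>A x') y' (a \<star> y))
        - (rsum2 (\<lambda>x y x' y'. \<phi> x (a \<star> (y \<circ>\<^sub>A y')) x') + rsum2 (\<lambda>x y x' y'. \<phi> x (a \<star> y') (y \<star> x'))
        + rsum2 (\<lambda>x y x' y'. \<phi> (x \<circ>\<^sub>A x') (a \<star> y) y'))"
      by (simp add: eval3_tmap3 eval3_id_tau Lstar_eq_star eval3_diamond)
    have "rsum2 (\<lambda>x y x' y'. \<phi> ((a \<circ>\<^sub>A x) \<circ>\<^sub>A x') y' y) = rsum2 (\<lambda>x y x' y'. \<phi> ((a \<circ>\<^sub>A x) \<circ>\<^sub>A x') y y')"
      using rsum2_swap[of "\<lambda>x y x' y'. \<phi> ((a \<circ>\<^sub>A x') \<circ>\<^sub>A x) y y'"]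
      by (simp add: right_commutative[of a])
    moreover have "rsum2 (\<lambda>x y x' y'. \<phi> x' ((a \<circ>\<^sub>A x) \<star> y') y) = - rsum2 (\<lambda>x y x' y'. \<phi> x (a \<star> (y \<circ>\<^sub>A y')) x')"
    proof -
      have "rsum2 (\<lambda>x y x' y'. \<phi> x (a \<star> (y \<circ>\<^sub>A y')) x') = - rsum2 (\<lambda>x y x' y'. \<phi> x (a \<star> (y \<circ>\<^sub>A x')) y')"
        by (rule rsum2_flip_right) (simp add: bilin)
      then show ?thesis
        using rsum2_swap[of "\<lambda>x y x' y'. \<phi> x (a \<star> (y \<circ>\<^sub>A x')) y'"] by (simp add: mul_star)
    qed
    moreover have "rsum2 (\<lambda>x y x' y'. \<phi> x' y ((a \<circ>\<^sub>A x) \<star> y')) = - rsum2 (\<lambda>x y x' y'. \<phi> x x' (a \<star> (y \<circ>\<^sub>A y')))"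
    proof -
      have "rsum2 (\<lambda>x y x' y'. \<phi> x y' (a \<star> (y \<circ>\<^sub>A x'))) = - rsum2 (\<lambda>x y x' y'. \<phi> x x' (a \<star> (y \<circ>\<^sub>A y')))"
        by (rule rsum2_flip_right) (simp add: bilin)
      then show ?thesis
        using rsum2_swap[of "\<lambda>x y x' y'. \<phi> x y' (a \<star> (y \<circ>\<^sub>A x'))"] by (simp add: mul_star)
    qed
    moreover have "rsum2 (\<lambda>x y x' y'. \<phi> x' (x \<star> y') (a \<star> y)) = rsum2 (\<lambda>x y x' y'. \<phi> x (y \<star> x') (a \<star> y'))"
      using rsum2_swap[of "\<lambda>x y x' y'. \<phi> x (y \<star> x') (a \<star> y')"] by (simp add: star_commute)
    moreover have "rsum2 (\<lambda>x y x' y'. \<phi> x' (a \<star> y) (x \<star> y')) = rsum2 (\<lambda>x y x' y'. \<phi> x (a \<star> y') (y \<star> x'))"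
      using rsum2_swap[of "\<lambda>x y x' y'. \<phi> x (a \<star> y') (y \<star> x')"] by (simp add: star_commute)
    ultimately show ?thesis
      unfolding rhs eval3_tau_id eval3_cop_id_Delta_r eval3_id_cop_tau_Delta_r
      by (simp only:) (simp add: algebra_simps)
  qed
  then have "eval3 \<phi> ?lhs1 = eval3 \<phi> ?lhs2 \<longleftrightarrow> eval3 \<phi> ?rhs = 0" if "trilinear_form scale \<phi>" for \<phi>
    using that by (metis right_minus_eq)
  then show ?thesis
    by (simp add: tens_eq3_iff del: eval_diff eval_add)
qed

section \<open>Compatibility of product and coproduct\<close>

lemma Delta_r_linear:
  "tens_eq2 scale (\<Delta> (a + b)) (\<Delta> a + \<Delta> b)" "tens_eq2 scale (\<Delta> (scale c a)) (fscale c (\<Delta> a))"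
  by (auto simp: tens_eq2_iff eval2_Delta_r multilinear_defs mul_linear star_linear rsum_add rsum_mult
      distrib_left)

lemma Delta_r_mul:
  "tens_eq2 scale (\<Delta> (a \<circ>\<^sub>A b))
    (tmap2 (R mul b) id (\<Delta> a) + tmap2 id (Lstar mul a) (\<Delta> b + tau (\<Delta> b)))"
  unfolding tens_eq2_iff
proof (intro allI impI)
  fix \<beta> assume \<beta>: "bilinear_form scale \<beta>"
  then have "bilinear_form scale (\<lambda>x y. \<beta> x (a \<star> y))"
    by (simp add: multilinear_defs star_linear)
  from eval2_Delta_r_sym[OF this, of b]
  show "eval2 \<beta> (\<Delta> (a \<circ>\<^sub>A b)) = eval2 \<beta>
      (tmap2 (R mul b) id (\<Delta> a) + tmap2 id (Lstar mul a) (\<Delta> b + tau (\<Delta> b)))"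
    by (simp add: eval2_tmap2 eval2_tau R_def Lstar_eq_star)
      (simp add: eval2_Delta_r mul_star right_commutative[of a b])
qed

lemma Delta_r_Lstar:
  "tens_eq2 scale
    (tmap2 (Lstar mul a) id (\<Delta> b) - tmap2 id (Lstar mul a) (tau (\<Delta> b)))
    (tmap2 (Lstar mul b) id (\<Delta> a) - tmap2 id (Lstar mul b) (tau (\<Delta> a)))"
  unfolding tens_eq2_iff
proof (intro allI impI)
  fix \<beta> assume \<beta>: "bilinear_form scale \<beta>"
  have "eval2 \<beta> (tmap2 (Lstar mul a) id (\<Delta> b) - tmap2 id (Lstar mul a) (tau (\<Delta> b)))
    = rsum (\<lambda>x y. \<beta> (a \<star> (b \<circ>\<^sub>A x)) y) + rsum (\<lambda>x y. \<beta> (a \<star> x) (b \<star> y))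
      + rsum (\<lambda>x y. \<beta> x (a \<star> (b \<circ>\<^sub>A y))) + rsum (\<lambda>x y. \<beta> (b \<star> x) (a \<star> y))" for a b
  proof -
    have "rsum (\<lambda>x y. \<beta> y (a \<star> (b \<circ>\<^sub>A x))) = - rsum (\<lambda>x y. \<beta> x (a \<star> (b \<circ>\<^sub>A y)))"
      "rsum (\<lambda>x y. \<beta> (b \<star> y) (a \<star> x)) = - rsum (\<lambda>x y. \<beta> (b \<star> x) (a \<star> y))"
      using \<beta> by (intro rsum_flip; simp add: multilinear_defs mul_linear star_linear)+
    then show ?thesis
      by (simp add: eval2_tmap2 eval2_tau Lstar_eq_star eval2_Delta_r)
  qed
  then show "eval2 \<beta> (tmap2 (Lstar mul a) id (\<Delta> b) - tmap2 id (Lstar mul a) (tau (\<Delta> b)))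
    = eval2 \<beta> (tmap2 (Lstar mul b) id (\<Delta> a) - tmap2 id (Lstar mul b) (tau (\<Delta> a)))"
    by (simp only:) (simp add: Lstar_exchange[of a b] algebra_simps)
qed

lemma Delta_r_R:
  "tens_eq2 scale
    (tmap2 id (R mul a) (\<Delta> b + tau (\<Delta> b)) - tmap2 (R mul a) id (\<Delta> b + tau (\<Delta> b)))
    (tmap2 id (R mul b) (\<Delta> a + tau (\<Delta> a)) - tmap2 (R mul b) id (\<Delta> a + tau (\<Delta> a)))"
  unfolding tens_eq2_iff
proof (intro allI impI)
  fix \<beta> assume \<beta>: "bilinear_form scale \<beta>"
  have "eval2 \<beta> (tmap2 id (R mul a) (\<Delta> b + tau (\<Delta> b)) - tmap2 (R mul a) id (\<Delta> b + tau (\<Delta> b)))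
    = rsum (\<lambda>x y. \<beta> x (y \<circ>\<^sub>A b \<circ>\<^sub>A a)) - rsum (\<lambda>x y. \<beta> (x \<circ>\<^sub>A b) (y \<circ>\<^sub>A a))
      - rsum (\<lambda>x y. \<beta> (x \<circ>\<^sub>A a) (y \<circ>\<^sub>A b)) + rsum (\<lambda>x y. \<beta> (x \<circ>\<^sub>A b \<circ>\<^sub>A a) y)" for a b
  proof -
    have "bilinear_form scale (\<lambda>x y. \<beta> x (y \<circ>\<^sub>A a))" "bilinear_form scale (\<lambda>x y. \<beta> (x \<circ>\<^sub>A a) y)"
      using \<beta> by (simp_all add: multilinear_defs mul_linear)
    from eval2_Delta_r_sym[OF this(1), of b] eval2_Delta_r_sym[OF this(2), of b]
    show ?thesis
      by (simp add: eval2_tmap2 eval2_tau R_def)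
  qed
  then show "eval2 \<beta> (tmap2 id (R mul a) (\<Delta> b + tau (\<Delta> b)) - tmap2 (R mul a) id (\<Delta> b + tau (\<Delta> b)))
    = eval2 \<beta> (tmap2 id (R mul b) (\<Delta> a + tau (\<Delta> a)) - tmap2 (R mul b) id (\<Delta> a + tau (\<Delta> a)))"
    by (simp only:) (simp add: right_commutative[of _ a b] algebra_simps)
qed

section \<open>The bialgebra criterion\<close>

lemma novikov_bialgebra_Delta_r_iff:
  "novikov_bialgebra scale mul \<Delta> \<longleftrightarrow>
    (\<forall>a. tens_eq3 scale
           (tmap3 (L mul a) id id (id_tau D) - tmap3 id (L mul a) id (id_tau D)
             + tmap3 id id (Lstar mul a) (D - tau_id D)) 0
       \<and> tens_eq3 scale (tmap3 id id (Lstar mul a) D - id_tau (tmap3 id id (Lstar mul a) D)) 0)"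
  (is "_ \<longleftrightarrow> ?R")
proof
  assume "novikov_bialgebra scale mul \<Delta>"
  then interpret bi: novikov_bialgebra scale mul \<Delta> .
  show ?R
    using bi.co_left_symmetric bi.co_right_commutative
    by (simp add: co_left_symmetric_iff co_right_commutative_iff)
next
  assume ?R
  then show "novikov_bialgebra scale mul \<Delta>"
    by unfold_locales
      (simp_all add: Delta_r_linear Delta_r_mul Delta_r_Lstar Delta_r_R
        co_left_symmetric_iff co_right_commutative_iff)
qed

lemma novikov_bialgebra_if_NYBE:
  assumes "NYBE scale mul r"
  shows "novikov_bialgebra scale mul \<Delta>"
proof -
  have D0: "eval3 \<psi> D = 0" if "trilinear_form scale \<psi>" for \<psi>
    using assms that by (auto simp: NYBE_def tens_eq3_iff)
  show ?thesis
    unfolding novikov_bialgebra_Delta_r_iff tens_eq3_iff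
  proof (intro allI conjI impI)
    fix a \<phi> assume \<phi>: "trilinear_form scale \<phi>"
    have "trilinear_form scale (\<lambda>p q s. \<phi> (a \<circ>\<^sub>A p) s q)" "trilinear_form scale (\<lambda>p q s. \<phi> p (a \<circ>\<^sub>A s) q)"
      "trilinear_form scale (\<lambda>p q s. \<phi> p q (a \<star> s))" "trilinear_form scale (\<lambda>p q s. \<phi> q p (a \<star> s))"
      "trilinear_form scale (\<lambda>p q s. \<phi> p (a \<star> s) q)"
      by (simp_all add: multilinear_defs mul_linear star_linear trilinear_simps[OF \<phi>])
    note vanish = this[THEN D0]
    show "eval3 \<phi> (tmap3 (L mul a) id id (id_tau D) - tmap3 id (L mul a) id (id_tau D)
        + tmap3 id id (Lstar mul a) (D - tau_id D)) = eval3 \<phi> 0"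
      using vanish by (simp add: eval3_tmap3 eval3_id_tau eval3_tau_id L_def Lstar_eq_star)
    show "eval3 \<phi> (tmap3 id id (Lstar mul a) D - id_tau (tmap3 id id (Lstar mul a) D)) = eval3 \<phi> 0"
      using vanish by (simp add: eval3_tmap3 eval3_id_tau Lstar_eq_star)
  qed
qed

end

theorem corollary3p23:
  fixes scale :: "'k::field_char_0 \<Rightarrow> 'a::ab_group_add \<Rightarrow> 'a"
    and Basis :: "'a set"
    and mul :: "'a \<Rightarrow> 'a \<Rightarrow> 'a"
    and r :: "('a, 'k) formal2"
  assumes "finite_dimensional_vector_space scale Basis"
    and "novikov_algebra scale mul"
    and "skewsymmetric scale r"
  shows "(novikov_bialgebra scale mul (Delta_r mul r) \<longleftrightarrow>
      (\<forall>a. tens_eq3 scale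
             (tmap3 (L mul a) id id (id_tau (diamond mul r))
              - tmap3 id (L mul a) id (id_tau (diamond mul r))
              + tmap3 id id (Lstar mul a) (diamond mul r - tau_id (diamond mul r))) 0
         \<and> tens_eq3 scale
             (tmap3 id id (Lstar mul a) (diamond mul r)
              - id_tau (tmap3 id id (Lstar mul a) (diamond mul r))) 0))
    \<and> (NYBE scale mul r \<longrightarrow> novikov_bialgebra scale mul (Delta_r mul r))"
proof -
  interpret novikov_skew_tensor scale mul r
    using assms(2,3) by (simp add: novikov_skew_tensor_def novikov_skew_tensor_axioms_def)
  show ?thesis
    using novikov_bialgebra_Delta_r_iff novikov_bialgebra_if_NYBE by blast
qed

end
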